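(* Let $(G,\bullet)$ be a finite Abelian group, and let $X=\{x_g\}_{g\in G}$ be a tight frame for $\mathbb{C}^d$. If $G$ defines a frame multiplication for $X$, with associated bilinear product $\ast:\mathbb{C}^d\times\mathbb{C}^d\to\mathbb{C}^d$ (so $x_g\ast x_h=x_{g\bullet h}$), then $X$ is unitarily equivalent to a harmonic frame, and there exist a unitary operator $U\in\mathcal{U}(\mathbb{C}^d)$ and $c>0$ such that $$\forall g,h\in G,\qquad cU(x_g\ast x_h)=cU(x_g)\,cU(x_h),$$ where the product on the right is the pointwise (coordinatewise) product of vectors in $\mathbb{C}^d$.
   Context: A sequence $X=\{x_g\}_{g\in G}$ (repetitions allowed) in $\mathbb{C}^d$ is a tight frame for $\mathbb{C}^d$ if there is $A>0$ such that $\sum_{g\in G}|\langle x,x_g\rangle|^2=A\|x\|^2$ for all $x\in \mathbb{C}^d$. $G$ defines a frame multiplication for $X=\{x_g\}_{g\in G}$ if there exists a bilinear product $\ast:\mathbb{C}^d\times \mathbb{C}^d\to \mathbb{C}^d$ such that $x_g\ast x_h=x_{g\bullet h}$ for all $g,h\in G$. Tight frames $X=\{x_g\}_{g\in G}$ and $Y=\{y_g\}_{g\in G}$ for $\mathbb{C}^d$ are unitarily equivalent if there are a unitary operator $U$ on $\mathbb{C}^d$ and a constant $c>0$ such that $x_g=cUy_g$ for all $g\in G$. Harmonic frame: let $G$ be a finite Abelian group of order $N$, with characters $\gamma_1,\dots,\gamma_N$ (the distinct homomorphisms from $G$ to the unit circle). For a subset $K=\{k_1,\dots,k_d\}\subseteq\{1,\dots,N\}$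 of cardinality $d\le N$ and a unitary $U\in\mathcal{U}(\mathbb{C}^d)$, the associated harmonic frame for $\mathbb{C}^d$, indexed by $G$, is $\{U(\gamma_{k_1}(g),\dots,\gamma_{k_d}(g))\}_{g\in G}$. *)

theory Defs
  imports "HOL-Analysis.Analysis" "HOL-Algebra.Group"
begin

text \<open>
  The space \<open>\<complex>\<^sup>d\<close> is \<^typ>\<open>complex ^ 'd\<close> with \<open>d = CARD('d)\<close>. The library's inner product,
  \<^const>\<open>linear\<close> and \<^const>\<open>bilinear\<close> refer to its structure as a real vector space, so the
  complex versions are given here; \<^const>\<open>norm\<close> is already the Hermitian norm.
\<close>

definition cinner :: "complex ^ 'd \<Rightarrow> complex ^ 'd \<Rightarrow> complex" where
  "cinner x y = (\<Sum>i\<in>UNIV. x $ i * cnj (y $ i))"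

abbreviation clinear :: "(complex ^ 'd \<Rightarrow> complex ^ 'd) \<Rightarrow> bool" where
  "clinear f \<equiv> Vector_Spaces.linear (*s) (*s) f"

definition cbilinear :: "(complex ^ 'd \<Rightarrow> complex ^ 'd \<Rightarrow> complex ^ 'd) \<Rightarrow> bool" where
  "cbilinear m \<longleftrightarrow> (\<forall>x. clinear (\<lambda>y. m x y)) \<and> (\<forall>y. clinear (\<lambda>x. m x y))"

definition unitary_op :: "(complex ^ 'd \<Rightarrow> complex ^ 'd) \<Rightarrow> bool" where
  "unitary_op U \<longleftrightarrow> clinear U \<and> surj U \<and> (\<forall>x y. cinner (U x) (U y) = cinner x y)"

definition tight_frame :: "'a set \<Rightarrow> ('a \<Rightarrow> complex ^ 'd) \<Rightarrow> bool" where
  "tight_frame I X \<longleftrightarrow>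
    (\<exists>A::real. A > 0 \<and> (\<forall>x. (\<Sum>g\<in>I. (cmod (cinner x (X g)))\<^sup>2) = A * (norm x)\<^sup>2))"

definition frame_multiplication ::
    "('a, 'b) monoid_scheme \<Rightarrow> ('a \<Rightarrow> complex ^ 'd) \<Rightarrow>
     (complex ^ 'd \<Rightarrow> complex ^ 'd \<Rightarrow> complex ^ 'd) \<Rightarrow> bool" where
  "frame_multiplication G X m \<longleftrightarrow>
    cbilinear m \<and>
    (\<forall>g\<in>carrier G. \<forall>h\<in>carrier G. m (X g) (X h) = X (g \<otimes>\<^bsub>G\<^esub> h))"

definition unitarily_equivalent ::
    "'a set \<Rightarrow> ('a \<Rightarrow> complex ^ 'd) \<Rightarrow> ('a \<Rightarrow> complex ^ 'd) \<Rightarrow> bool" where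
  "unitarily_equivalent I X Y \<longleftrightarrow>
    tight_frame I X \<and> tight_frame I Y \<and>
    (\<exists>U. \<exists>c::real. unitary_op U \<and> c > 0 \<and> (\<forall>g\<in>I. X g = c *\<^sub>R U (Y g)))"

definition circle_group :: "complex monoid" where
  "circle_group = \<lparr>carrier = sphere 0 1, monoid.mult = (*), one = 1\<rparr>"

text \<open>
  Restricting to \<^const>\<open>extensional\<close> functions makes equality of functions coincide with
  equality on the carrier, so that distinct elements are distinct homomorphisms.
\<close>

definition characters :: "('a, 'b) monoid_scheme \<Rightarrow> ('a \<Rightarrow> complex) set" where
  "characters G = hom G circle_group \<inter> extensional (carrier G)"

text \<open>
  The subset \<open>K\<close> selects \<open>d\<close> distinct characters, listed by \<open>\<gamma>\<close> as \<open>\<gamma>\<^sub>k\<^sub>1, \<dots>, \<gamma>\<^sub>k\<^sub>d\<close>.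
\<close>

definition harmonic_frame ::
    "('a, 'b) monoid_scheme \<Rightarrow> ('a \<Rightarrow> complex ^ 'd) \<Rightarrow> bool" where
  "harmonic_frame G Y \<longleftrightarrow>
    (\<exists>K \<gamma> U. K \<subseteq> characters G \<and> bij_betw \<gamma> (UNIV :: 'd set) K \<and> unitary_op U \<and>
      (\<forall>g\<in>carrier G. Y g = U (\<chi> i. \<gamma> i g)))"

end

theory Submission
  imports Defs "HOL-Algebra.Multiplicative_Group"
begin

text \<open>
  Multiplication by \<open>x\<^sub>h\<close> permutes the frame, so its adjoint \<open>M\<^sub>h\<close> satisfies
  \<open>\<langle>x\<^sub>k, M\<^sub>h v\<rangle> = \<langle>x\<^bsub>hk\<^esub>, v\<rangle>\<close>, and these operators represent \<open>G\<close>. Common eigenvectors of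
  the \<open>M\<^sub>h\<close> span the space, and such an eigenvector \<open>v \<noteq> 0\<close> can be rescaled so that
  \<open>g \<mapsto> \<langle>x\<^sub>g, v\<rangle>\<close> is a character. By the polarised frame identity
  \<open>A \<langle>v, w\<rangle> = \<Sum>\<^sub>g \<langle>v, x\<^sub>g\<rangle> \<langle>x\<^sub>g, w\<rangle>\<close>, orthogonality of characters makes the rescaled
  eigenvectors orthogonal, all of squared norm \<open>|G| / A\<close>. There are therefore \<open>d\<close> of them, and
  in the resulting orthonormal basis \<open>x\<^sub>g\<close> has coordinates proportional to \<open>\<gamma>\<^sub>1(g), \<dots>, \<gamma>\<^sub>d(g)\<close>.
\<close>

section \<open>Hermitian inner product, adjoints and the polarised frame identity\<close>

lemma cinner_simps:
  "cinner (x + y) z = cinner x z + cinner y z"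
  "cinner x (y + z) = cinner x y + cinner x z"
  "cinner (a *s x) y = a * cinner x y"
  "cinner x (a *s y) = cnj a * cinner x y"
  by (simp_all add: cinner_def algebra_simps sum.distrib sum_distrib_left)

lemma cinner_commute: "cinner y x = cnj (cinner x y)"
  by (simp add: cinner_def mult.commute)

lemma cinner_zero [simp]: "cinner 0 x = 0" "cinner x 0 = 0"
  by (simp_all add: cinner_def)

lemma cinner_sum:
  "cinner (\<Sum>i\<in>I. f i) y = (\<Sum>i\<in>I. cinner (f i) y)"
  "cinner y (\<Sum>i\<in>I. f i) = (\<Sum>i\<in>I. cinner y (f i))"
  by (induction I rule: infinite_finite_induct) (simp_all add: cinner_simps)

lemma cinner_self: "cinner x x = complex_of_real ((norm x)\<^sup>2)"
proof -
  have "(norm x)\<^sup>2 = (\<Sum>i\<in>UNIV. (cmod (x $ i))\<^sup>2)"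
    by (simp add: norm_vec_def L2_set_def sum_nonneg)
  then show ?thesis
    by (simp only: cinner_def of_real_sum complex_norm_square)
qed

lemma clinear_vec_component: "clinear f \<Longrightarrow> f x = (\<Sum>i\<in>UNIV. x $ i *s f (axis i 1))"
  by (subst basis_expansion [of x, symmetric])
    (simp add: vec.linear_sum vec.linear_scale)

lemma clinearI:
  assumes "\<And>x y. f (x + y) = f x + f y" "\<And>a x. f (a *s x) = a *s f x"
  shows "clinear f"
  using assms by unfold_locales auto

text \<open>Written through the values of \<open>f\<close> on the standard basis, so it is total; it
  acts as the adjoint once \<open>f\<close> is complex linear.\<close>

definition cadjoint :: "(complex ^ 'd \<Rightarrow> complex ^ 'd) \<Rightarrow> complex ^ 'd \<Rightarrow> complex ^ 'd" where
  "cadjoint f y = (\<chi> i. cnj (cinner (f (axis i 1)) y))"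

lemma cinner_cadjoint: "clinear f \<Longrightarrow> cinner x (cadjoint f y) = cinner (f x) y"
  by (subst clinear_vec_component [of f x])
    (simp_all add: cinner_sum cinner_simps, simp add: cadjoint_def cinner_def)

text \<open>The defect \<open>Q\<close> of the identity is sesquilinear and vanishes on the
  diagonal. Testing it at \<open>x + y\<close> makes it antisymmetric, at
  \<open>x + \<i> *s y\<close> symmetric, so it is zero.\<close>

lemma sum_frame_eq_cinner:
  fixes A :: real
  assumes "\<And>x. (\<Sum>g\<in>I. (cmod (cinner x (X g)))\<^sup>2) = A * (norm x)\<^sup>2"
  shows "(\<Sum>g\<in>I. cinner x (X g) * cinner (X g) y) = A * cinner x y"
proof -
  define Q where "Q x y = (\<Sum>g\<in>I. cinner x (X g) * cinner (X g) y) - A * cinner x y" for x y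
  have diag: "Q x x = 0" for x
  proof -
    have "(\<Sum>g\<in>I. cinner x (X g) * cinner (X g) x) =
        complex_of_real (\<Sum>g\<in>I. (cmod (cinner x (X g)))\<^sup>2)"
      by (simp only: of_real_sum complex_norm_square cinner_commute [of _ x])
    then show ?thesis
      by (simp only: Q_def assms cinner_self) simp
  qed
  have add: "Q (x + y) z = Q x z + Q y z" "Q x (y + z) = Q x y + Q x z" for x y z
    by (simp_all add: Q_def cinner_simps algebra_simps sum.distrib)
  have scale: "Q (a *s x) y = a * Q x y" "Q x (a *s y) = cnj a * Q x y" for a x y
    by (simp_all add: Q_def cinner_simps algebra_simps sum_distrib_left)
  have 1: "Q x y + Q y x = 0"
    using diag [of "x + y", unfolded add] by (simp add: diag add.commute)
  have "\<i> * Q y x - \<i> * Q x y = 0"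
    using diag [of "x + \<i> *s y", unfolded add scale] by (simp add: diag)
  then have "Q x y = Q y x" by simp
  with 1 have "Q x y = 0" by simp
  then show ?thesis by (simp add: Q_def)
qed

section \<open>Common eigenvectors of commuting operators of finite order\<close>

lemma sum_roots_unity_powers:
  assumes "j < n"
  shows "(\<Sum>k<n. (exp (2 * of_real pi * \<i> * of_nat j / of_nat n)) ^ k) = (if j = 0 then of_nat n else 0)"
proof (cases "j = 0")
  case False
  let ?z = "exp (2 * of_real pi * \<i> * of_nat j / of_nat n)"
  have "?z \<noteq> 1"
    using assms False complex_root_unity_eq_1 [of n j] by (auto dest: nat_dvd_not_less)
  moreover have "?z ^ n = 1"
    using assms complex_root_unity [of n j] by simp
  ultimately show ?thesis
    using False by (simp add: geometric_sum)
qed simp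

text \<open>Averaging the orbit of \<open>v\<close> against the powers of a root of unity gives an eigenvector,
  and the sum of these averages over all \<open>n\<close>-th roots of unity is a multiple of \<open>v\<close>.\<close>

lemma finite_order_eigenvector_decomposition:
  fixes T :: "complex ^ 'd \<Rightarrow> complex ^ 'd"
  assumes T: "clinear T" and n: "n > 0" and "(T ^^ n) v = v"
  obtains u :: "nat \<Rightarrow> complex ^ 'd" and \<mu> a
    where "v = (\<Sum>k<n. u k)" "\<And>k. T (u k) = \<mu> k *s u k"
      "\<And>k. u k = (\<Sum>j<n. a k j *s (T ^^ j) v)"
proof
  define \<omega> where "\<omega> k = exp (2 * of_real pi * \<i> * of_nat k / of_nat n)" for k
  have \<omega>n: "\<omega> k ^ n = 1" and \<omega>0: "\<omega> k \<noteq> 0" for k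
    using n complex_root_unity [of n k] by (simp_all add: \<omega>_def)
  \<comment> \<open>Swapping the roles of \<open>j\<close> and \<open>k\<close> turns the sum of
    \<open>a k j\<close> over \<open>k\<close> into a geometric sum, which vanishes unless
    \<open>j = 0\<close>.\<close>
  have \<omega>sym: "\<omega> k ^ j = \<omega> j ^ k" for j k
    by (simp add: \<omega>_def exp_of_nat_mult [symmetric] algebra_simps)
  define a where "a k j = \<omega> k ^ j / of_nat n" for k j
  define u where "u k = (\<Sum>j<n. a k j *s (T ^^ j) v)" for k
  show "u k = (\<Sum>j<n. a k j *s (T ^^ j) v)" for k by (fact u_def)
  have "(\<Sum>k<n. u k) = (\<Sum>j<n. (\<Sum>k<n. a k j) *s (T ^^ j) v)"
    unfolding u_def by (subst sum.swap) (simp add: vec.scale_sum_left)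
  also have "\<dots> = (\<Sum>j<n. if j = 0 then v else 0)"
  proof (rule sum.cong)
    fix j assume "j \<in> {..<n}"
    moreover have "(\<Sum>k<n. a k j) = (\<Sum>k<n. \<omega> j ^ k) / of_nat n"
      by (simp add: a_def \<omega>sym [of _ j] sum_divide_distrib)
    ultimately show "(\<Sum>k<n. a k j) *s (T ^^ j) v = (if j = 0 then v else 0)"
      using n sum_roots_unity_powers [of j n] by (simp add: \<omega>_def)
  qed simp
  also have "\<dots> = v" using n by simp
  finally show "v = (\<Sum>k<n. u k)" by simp
  show "T (u k) = inverse (\<omega> k) *s u k" for k
  proof -
    let ?b = "\<lambda>j. a k j *s (T ^^ j) v"
    \<comment> \<open>Multiplying by \<open>\<omega> k\<close> shifts the summation index by one.
      The boundary terms at \<open>n\<close> and \<open>0\<close> cancel because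
      \<open>\<omega> k ^ n = 1\<close> and \<open>(T ^^ n) v = v\<close>.\<close>
    have "\<omega> k *s T (u k) = (\<Sum>j<n. ?b (Suc j))"
      by (simp add: u_def vec.linear_sum [OF T] vec.linear_scale [OF T] vec.scale_sum_right a_def)
    also have "\<dots> = (\<Sum>j<n. ?b j) + ?b n - ?b 0"
      using sum.lessThan_Suc [of ?b n] sum.lessThan_Suc_shift [of ?b n] by (simp add: algebra_simps)
    also have "\<dots> = u k" using assms(3) by (simp add: u_def a_def \<omega>n)
    finally show ?thesis
      using \<omega>0 by (metis vec.scale_scale left_inverse vec.scale_one)
  qed
qed

text \<open>Commuting operators can be diagonalised one at a time: splitting a vector along one of
  them keeps it an eigenvector of those already treated.\<close>

lemma common_eigenvectors_span:
  fixes G :: "('a, 'b) monoid_scheme" and M :: "'a \<Rightarrow> complex ^ 'd \<Rightarrow> complex ^ 'd"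
  assumes "comm_group G" and fin: "finite (carrier G)"
    and lin: "\<And>g. g \<in> carrier G \<Longrightarrow> clinear (M g)"
    and M_one: "\<And>v. M \<one>\<^bsub>G\<^esub> v = v"
    and M_mult: "\<And>g h v. g \<in> carrier G \<Longrightarrow> h \<in> carrier G \<Longrightarrow> M (g \<otimes>\<^bsub>G\<^esub> h) v = M g (M h v)"
  shows "v \<in> vec.span {v. \<forall>g\<in>carrier G. \<exists>l. M g v = l *s v}"
proof -
  interpret G: comm_group G by fact
  define S where "S = vec.span {v. \<forall>g\<in>carrier G. \<exists>l. M g v = l *s v}"
  \<comment> \<open>Induction on the set \<open>H\<close> of elements still to be treated; outside
    \<open>H\<close> the vector is already an eigenvector. For \<open>H = carrier G\<close> that
    condition is vacuous.\<close>
  have "v \<in> S" if "finite H" "H \<subseteq> carrier G"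
      "\<forall>g\<in>carrier G - H. \<exists>l. M g v = l *s v" for H v
    using that
  proof (induction H arbitrary: v rule: finite_induct)
    case empty
    then show ?case by (auto simp: S_def intro!: vec.span_base)
  next
    case (insert h H)
    then have h: "h \<in> carrier G" by simp
    have pow: "(M h ^^ j) w = M (h [^]\<^bsub>G\<^esub> j) w" for j :: nat and w
    proof (induction j)
      case (Suc j)
      have "(M h ^^ Suc j) w = M (h \<otimes>\<^bsub>G\<^esub> h [^]\<^bsub>G\<^esub> j) w"
        using Suc h by (simp add: M_mult)
      then show ?case using G.nat_pow_Suc2 [OF h, of j] by (simp only:)
    qed (simp add: M_one)
    have "0 < order G" using fin by (simp add: G.order_gt_0_iff_finite)
    moreover have "(M h ^^ order G) v = v"
      using h by (simp add: pow G.pow_order_eq_1 M_one)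
    ultimately obtain u \<mu> a where v: "v = (\<Sum>k<order G. u k)"
      and eig: "\<And>k. M h (u k) = \<mu> k *s u k"
      and u: "\<And>k. u k = (\<Sum>j<order G. a k j *s (M h ^^ j) v)"
      using finite_order_eigenvector_decomposition [OF lin [OF h], of "order G" v] by blast
    have "u k \<in> S" for k
    proof (rule insert.IH)
      show "\<forall>g\<in>carrier G - H. \<exists>l. M g (u k) = l *s u k"
      proof
        fix g assume g: "g \<in> carrier G - H"
        show "\<exists>l. M g (u k) = l *s u k"
        proof (cases "g = h")
          case True
          then show ?thesis using eig by blast
        next
          case False
          then obtain l where l: "M g v = l *s v" using g insert.prems by blast
          \<comment> \<open>The whole orbit of \<open>v\<close> under \<open>M h\<close> inherits
            the eigenvalue \<open>l\<close> of \<open>M g\<close>, hence so does \<open>u k\<close>,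
            a combination of orbit points.\<close>
          have "M g ((M h ^^ j) v) = l *s (M h ^^ j) v" for j
          proof -
            have "M g ((M h ^^ j) v) = M (h [^]\<^bsub>G\<^esub> j) (M g v)"
              using g h by (simp add: pow M_mult [symmetric] G.m_comm)
            then show ?thesis using h by (simp add: l pow vec.linear_scale [OF lin])
          qed
          then have "M g (u k) = l *s u k"
            using g by (simp add: u vec.linear_sum [OF lin] vec.linear_scale [OF lin]
                vec.scale_sum_right mult.commute)
          then show ?thesis by blast
        qed
      qed
    qed (use insert.prems in auto)
    then show ?case unfolding v S_def by (intro vec.span_sum)
  qed
  from this [OF fin] show ?thesis by (simp add: S_def)
qed

section \<open>Characters and their orthogonality\<close>

lemma character_mult:
  "\<gamma> \<in> characters G \<Longrightarrow> g \<in> carrier G \<Longrightarrow> h \<in> carrier G \<Longrightarrow> \<gamma> (g \<otimes>\<^bsub>G\<^esub> h) = \<gamma> g * \<gamma> h"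
  by (auto simp: characters_def hom_def circle_group_def)

lemma norm_character: "\<gamma> \<in> characters G \<Longrightarrow> g \<in> carrier G \<Longrightarrow> cmod (\<gamma> g) = 1"
  by (auto simp: characters_def hom_def circle_group_def Pi_def)

lemma characters_eqI:
  "\<gamma> \<in> characters G \<Longrightarrow> \<delta> \<in> characters G \<Longrightarrow> (\<And>g. g \<in> carrier G \<Longrightarrow> \<gamma> g = \<delta> g) \<Longrightarrow> \<gamma> = \<delta>"
  by (auto simp: characters_def intro: extensionalityI)

text \<open>Values lie on the unit circle automatically: \<open>g\<close> to the power
  \<open>order G\<close> is the identity, so \<open>f g\<close> is a root of unity.\<close>

lemma restrict_in_characters:
  assumes "group G" "finite (carrier G)" "f \<one>\<^bsub>G\<^esub> = 1"
    and mult: "\<And>g h. g \<in> carrier G \<Longrightarrow> h \<in> carrier G \<Longrightarrow> f (g \<otimes>\<^bsub>G\<^esub> h) = f g * f h"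
  shows "restrict f (carrier G) \<in> characters G"
proof -
  interpret group G by fact
  have pow: "f (g [^]\<^bsub>G\<^esub> n) = f g ^ n" if "g \<in> carrier G" for g and n :: nat
    using that by (induction n) (simp_all add: assms(3) mult)
  have "cmod (f g) = 1" if "g \<in> carrier G" for g
  proof -
    have "cmod (f g) ^ order G = 1"
      using that pow [OF that, of "order G"] assms(3)
      by (simp add: pow_order_eq_1 norm_power [symmetric])
    moreover have "0 < order G" using assms(2) by (simp add: order_gt_0_iff_finite)
    ultimately show ?thesis using power_eq_imp_eq_base [of "cmod (f g)" "order G" 1] by simp
  qed
  then show ?thesis
    by (auto simp: characters_def hom_def circle_group_def mult)
qed

text \<open>Translating the summation variable by a \<open>k\<close> where the characters differ
  multiplies the sum by \<open>cnj (\<gamma> k) * \<delta> k\<close>. This factor is not 1, since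
  \<open>cnj (\<gamma> k)\<close> is the inverse of \<open>\<gamma> k\<close>.\<close>

lemma sum_characters_orthogonal:
  fixes G :: "('a, 'b) monoid_scheme"
  assumes "group G" and \<gamma>: "\<gamma> \<in> characters G" and \<delta>: "\<delta> \<in> characters G"
  shows "(\<Sum>g\<in>carrier G. cnj (\<gamma> g) * \<delta> g) = (if \<gamma> = \<delta> then of_nat (order G) else 0)"
proof (cases "\<gamma> = \<delta>")
  case True
  have "cnj (\<delta> g) * \<delta> g = 1" if "g \<in> carrier G" for g
    using norm_character [OF \<delta> that] complex_norm_square [of "\<delta> g"] by (simp add: mult.commute)
  then show ?thesis by (simp add: True order_def)
next
  case False
  interpret group G by fact
  from False obtain k where k: "k \<in> carrier G" "\<gamma> k \<noteq> \<delta> k"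
    using characters_eqI [OF \<gamma> \<delta>] by blast
  let ?S = "\<Sum>g\<in>carrier G. cnj (\<gamma> g) * \<delta> g"
  have "bij_betw (\<lambda>g. k \<otimes>\<^bsub>G\<^esub> g) (carrier G) (carrier G)"
    using k by (simp add: bij_betw_def inj_on_cmult surj_const_mult)
  then have "?S = (\<Sum>g\<in>carrier G. cnj (\<gamma> (k \<otimes>\<^bsub>G\<^esub> g)) * \<delta> (k \<otimes>\<^bsub>G\<^esub> g))"
    by (rule sum.reindex_bij_betw [symmetric])
  also have "\<dots> = cnj (\<gamma> k) * \<delta> k * ?S"
    using k by (simp add: character_mult [OF \<gamma>] character_mult [OF \<delta>] sum_distrib_left mult_ac)
  finally have "?S = 0 \<or> cnj (\<gamma> k) * \<delta> k = 1" by auto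
  moreover have "\<gamma> k * cnj (\<gamma> k) = 1"
    using norm_character [OF \<gamma> k(1)] complex_norm_square [of "\<gamma> k"] by simp
  then have "cnj (\<gamma> k) * \<delta> k \<noteq> 1"
    using k(2) by (metis mult.assoc mult.commute mult.right_neutral)
  ultimately show ?thesis using False by auto
qed

section \<open>Orthogonal families and unitary coordinate maps\<close>

lemma orthogonal_imp_cindependent:
  assumes "0 \<notin> B" and orth: "\<And>x y. x \<in> B \<Longrightarrow> y \<in> B \<Longrightarrow> x \<noteq> y \<Longrightarrow> cinner x y = 0"
  shows "vec.independent (B :: (complex ^ 'd) set)"
proof
  assume "vec.dependent B"
  then obtain t u v where t: "finite t" "t \<subseteq> B" "(\<Sum>b\<in>t. u b *s b) = 0" and v: "v \<in> t" "u v \<noteq> 0"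
    by (auto simp: vec.dependent_explicit)
  have "0 = cinner (\<Sum>b\<in>t. u b *s b) v" by (simp add: t)
  also have "\<dots> = (\<Sum>b\<in>t. if b = v then u v * cinner v v else 0)"
    unfolding cinner_sum cinner_simps using t v orth by (intro sum.cong) auto
  also have "\<dots> = u v * cinner v v" using t v by simp
  finally show False using v t assms(1) by (auto simp: cinner_self)
qed

text \<open>The synthesis map of an orthonormal family is injective, hence onto by dimension.\<close>

lemma unitary_op_orthonormal_basis:
  fixes e :: "'d \<Rightarrow> complex ^ 'd"
  assumes orth: "\<And>i j. cinner (e i) (e j) = (if i = j then 1 else 0)"
  defines "U \<equiv> \<lambda>x. \<chi> i. cinner x (e i)" and "V \<equiv> \<lambda>y. \<Sum>i\<in>UNIV. y $ i *s e i"
  shows "unitary_op U" "unitary_op V" "V (U x) = x"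
proof -
  have linU: "clinear U"
    by (rule clinearI) (simp_all add: U_def cinner_simps vec_eq_iff)
  have linV: "clinear V"
    by (rule clinearI) (simp_all add: V_def vec.scale_left_distrib sum.distrib vec.scale_sum_right)
  have comp: "cinner (V y) (e j) = y $ j" for y j
    by (simp add: V_def cinner_sum cinner_simps orth if_distrib cong: if_cong)
  then have UV: "U (V y) = y" for y by (simp add: U_def vec_eq_iff)
  then have "surj V"
    using vec.linear_inj_imp_surj [OF linV] by (metis injI)
  then show VU: "V (U x) = x" for x using UV by (metis surjD)
  have iso: "cinner (V y) (V z) = cinner y z" for y z
  proof -
    have "cinner (V y) (V z) = (\<Sum>i\<in>UNIV. cnj (z $ i) * cinner (V y) (e i))"
      \<comment> \<open>Only the second argument is expanded, so that \<open>comp\<close> evaluates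
        the remaining factors \<open>cinner (V y) (e i)\<close>.\<close>
      by (subst V_def [THEN meta_eq_to_obj_eq, THEN fun_cong, of z]) (simp add: cinner_sum cinner_simps)
    then show ?thesis by (simp only: comp) (simp add: cinner_def mult.commute)
  qed
  show "unitary_op V" using linV \<open>surj V\<close> iso by (simp add: unitary_op_def)
  show "unitary_op U"
    using linU UV iso VU unfolding unitary_op_def by (metis surj_def)
qed

section \<open>Characters as coordinates of the frame\<close>

lemma harmonic_coordinates:
  fixes G :: "('a, 'b) monoid_scheme"
    and X :: "'a \<Rightarrow> complex ^ 'd"
  assumes "comm_group G" and fin: "finite (carrier G)"
    and "A > 0" and tight: "\<And>x. (\<Sum>g\<in>carrier G. (cmod (cinner x (X g)))\<^sup>2) = A * (norm x)\<^sup>2"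
    and mult: "frame_multiplication G X m"
  obtains \<gamma> :: "'d \<Rightarrow> 'a \<Rightarrow> complex" and w :: "'d \<Rightarrow> complex ^ 'd"
  where "range \<gamma> \<subseteq> characters G" "inj \<gamma>"
    "\<And>g i. g \<in> carrier G \<Longrightarrow> cinner (X g) (w i) = \<gamma> i g"
    "\<And>i j. cinner (w i) (w j) = (if i = j then of_nat (order G) / A else 0)"
proof -
  interpret G: comm_group G by fact
  note frame = sum_frame_eq_cinner [where I = "carrier G" and X = X, OF tight]
  \<comment> \<open>By the frame identity a vector is determined by its pairings with the frame.
    Identities for \<open>M\<close> are therefore tested only on frame vectors, where the product is
    known.\<close>
  have eqI: "v = v'" if "\<And>g. g \<in> carrier G \<Longrightarrow> cinner (X g) v = cinner (X g) v'" for v v'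
  proof -
    have "A * cinner x v = A * cinner x v'" for x
      unfolding frame [symmetric] by (simp add: that)
    then have "cinner x (v - v') = 0" for x
      using \<open>A > 0\<close> cinner_simps(2) [of x "v - v'" v'] by simp
    from this [of "v - v'"] show ?thesis by (simp add: cinner_self)
  qed
  define M where "M g = cadjoint (m (X g))" for g
  have M: "cinner (X k) (M g v) = cinner (X (g \<otimes>\<^bsub>G\<^esub> k)) v"
    if "g \<in> carrier G" "k \<in> carrier G" for g k v
  proof -
    have "clinear (m (X g))" "m (X g) (X k) = X (g \<otimes>\<^bsub>G\<^esub> k)"
      using mult that by (auto simp: frame_multiplication_def cbilinear_def)
    then show ?thesis by (simp add: M_def cinner_cadjoint)
  qed
  have linM: "clinear (M g)" if "g \<in> carrier G" for g
    using that by (intro clinearI eqI) (simp_all add: M cinner_simps)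
  have M_one: "M \<one>\<^bsub>G\<^esub> v = v" for v by (rule eqI) (simp add: M)
  \<comment> \<open>Taking adjoints reverses the order of composition; commutativity of
    \<open>G\<close> restores it.\<close>
  have M_mult: "M (g \<otimes>\<^bsub>G\<^esub> h) v = M g (M h v)" if "g \<in> carrier G" "h \<in> carrier G" for g h v
    using that by (intro eqI) (simp add: M G.m_ac)
  have span: "v \<in> vec.span {v. \<forall>g\<in>carrier G. \<exists>l. M g v = l *s v}" for v
    by (rule common_eigenvectors_span [OF assms(1) fin linM M_one M_mult])
  \<comment> \<open>Indexing by the characters that occur, rather than by eigenvectors, leaves one
    vector per character.\<close>
  define K where "K = {\<gamma> \<in> characters G. \<exists>w. \<forall>g\<in>carrier G. cinner (X g) w = \<gamma> g}"
  have "\<exists>w. \<forall>\<gamma>\<in>K. \<forall>g\<in>carrier G. cinner (X g) (w \<gamma>) = \<gamma> g"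
    by (rule bchoice) (auto simp: K_def)
  then obtain w where w: "\<And>\<gamma> g. \<gamma> \<in> K \<Longrightarrow> g \<in> carrier G \<Longrightarrow> cinner (X g) (w \<gamma>) = \<gamma> g"
    by blast
  have Kc: "\<gamma> \<in> characters G" if "\<gamma> \<in> K" for \<gamma> using that by (simp add: K_def)
  have eig: "v \<in> vec.span (w ` K)" if v: "\<forall>g\<in>carrier G. \<exists>l. M g v = l *s v" for v
  proof (cases "v = 0")
    case False
    from v obtain l where l: "\<And>g. g \<in> carrier G \<Longrightarrow> M g v = l g *s v" by metis
    \<comment> \<open>The pairing at the identity fixes the scale of \<open>v\<close>: all other
      pairings are multiples of \<open>a\<close>, so \<open>a = 0\<close> would force
      \<open>v = 0\<close>.\<close>
    define a where "a = cinner (X \<one>\<^bsub>G\<^esub>) v"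
    have Xv: "cinner (X g) v = cnj (l g) * a" if "g \<in> carrier G" for g
      using M [OF that G.one_closed, of v] that by (simp add: l cinner_simps a_def)
    have "a \<noteq> 0"
      using False eqI [of v 0] Xv by auto
    \<comment> \<open>The conjugate appears because \<open>cinner\<close> is conjugate linear in its
      second argument.\<close>
    define \<gamma> where "\<gamma> = restrict (\<lambda>g. cnj (l g)) (carrier G)"
    have "\<gamma> \<in> characters G"
      unfolding \<gamma>_def
    proof (rule restrict_in_characters [OF G.is_group fin])
      have "l \<one>\<^bsub>G\<^esub> *s v = 1 *s v" using l [of "\<one>\<^bsub>G\<^esub>"] by (simp add: M_one)
      then show "cnj (l \<one>\<^bsub>G\<^esub>) = 1" using False by (simp only: vec.scale_cancel_right) simp
      fix g h assume gh: "g \<in> carrier G" "h \<in> carrier G"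
      have "l (g \<otimes>\<^bsub>G\<^esub> h) *s v = (l g * l h) *s v"
        using gh M_mult [OF gh, of v] by (simp add: l vec.linear_scale [OF linM] mult.commute)
      then show "cnj (l (g \<otimes>\<^bsub>G\<^esub> h)) = cnj (l g) * cnj (l h)"
        using False by simp
    qed
    moreover have nrm: "cinner (X g) (inverse (cnj a) *s v) = \<gamma> g" if "g \<in> carrier G" for g
      using that \<open>a \<noteq> 0\<close> by (simp add: cinner_simps Xv \<gamma>_def)
    ultimately have "\<gamma> \<in> K" unfolding K_def by blast
    \<comment> \<open>A vector representing a given character is unique by \<open>eqI\<close>, so
      the chosen \<open>w \<gamma>\<close> is the rescaled \<open>v\<close>.\<close>
    then have "inverse (cnj a) *s v = w \<gamma>" by (intro eqI) (simp only: w nrm)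
    then have "v = cnj a *s w \<gamma>" using \<open>a \<noteq> 0\<close>
      by (metis complex_cnj_zero_iff right_inverse vec.scale_one vec.scale_scale)
    then show ?thesis using \<open>\<gamma> \<in> K\<close> by (simp add: vec.span_base vec.span_scale)
  qed (simp add: vec.span_zero)
  have spanK: "vec.span (w ` K) = UNIV"
  proof -
    have "vec.span {v. \<forall>g\<in>carrier G. \<exists>l. M g v = l *s v} \<subseteq> vec.span (w ` K)"
      by (rule vec.span_minimal) (auto intro: eig)
    with span show ?thesis by blast
  qed
  have orth: "cinner (w \<gamma>) (w \<delta>) = (if \<gamma> = \<delta> then of_nat (order G) / A else 0)"
    if "\<gamma> \<in> K" "\<delta> \<in> K" for \<gamma> \<delta>
  proof -
    have "A * cinner (w \<gamma>) (w \<delta>) = (\<Sum>g\<in>carrier G. cnj (\<gamma> g) * \<delta> g)"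
      unfolding frame [symmetric] by (rule sum.cong) (simp_all add: that w cinner_commute [of "w _" "X _"])
    also have "\<dots> = (if \<gamma> = \<delta> then of_nat (order G) else 0)"
      using that by (simp add: sum_characters_orthogonal [OF G.is_group] Kc)
    finally show ?thesis using \<open>A > 0\<close> by (auto simp: field_simps)
  qed
  have inj: "inj_on w K"
  proof (rule inj_onI)
    fix \<gamma> \<delta> assume *: "\<gamma> \<in> K" "\<delta> \<in> K" "w \<gamma> = w \<delta>"
    show "\<gamma> = \<delta>"
      by (rule characters_eqI [OF Kc Kc]) (use * in \<open>simp_all flip: w\<close>)
  qed
  have "order G > 0" using fin by (simp add: G.order_gt_0_iff_finite)
  have "0 \<notin> w ` K"
  proof
    assume "0 \<in> w ` K"
    then obtain \<gamma> where "\<gamma> \<in> K" "w \<gamma> = 0" by auto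
    with orth [of \<gamma> \<gamma>] \<open>order G > 0\<close> \<open>A > 0\<close> show False by simp
  qed
  then have ind: "vec.independent (w ` K)"
    by (rule orthogonal_imp_cindependent) (auto simp: orth)
  then have "finite (w ` K)" by (rule vec.finiteI_independent)
  then have "finite K" using inj by (simp add: finite_image_iff)
  \<comment> \<open>\<open>w\<close> is injective on \<open>K\<close> and its image is a basis, so
    \<open>K\<close> has as many elements as the dimension and can be listed by the index
    type.\<close>
  have "card K = CARD('d)"
    using vec.dim_eq_card_independent [OF ind] vec.dim_span [of "w ` K"] spanK inj
    by (simp add: card_image card_cart_basis)
  then obtain f where f: "bij_betw f (UNIV :: 'd set) K"
    using \<open>finite K\<close> by (metis finite finite_same_card_bij)
  then have fK: "f i \<in> K" "f i = f j \<longleftrightarrow> i = j" for i j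
    by (auto simp: bij_betw_def inj_eq)
  show ?thesis
    by (rule that [of f "\<lambda>i. w (f i)"]) (auto simp: fK Kc w orth inj_def)
qed

section \<open>Normalisation and transfer to the harmonic frame\<close>

theorem theorem7p4:
  fixes G :: "('a, 'b) monoid_scheme"
    and X :: "'a \<Rightarrow> complex ^ 'd"
    and m :: "complex ^ 'd \<Rightarrow> complex ^ 'd \<Rightarrow> complex ^ 'd"
  assumes "comm_group G" and "finite (carrier G)"
    and "tight_frame (carrier G) X"
    and "frame_multiplication G X m"
  shows "(\<exists>Y. harmonic_frame G Y \<and> unitarily_equivalent (carrier G) X Y) \<and>
    (\<exists>U. \<exists>c::real. unitary_op U \<and> c > 0 \<and>
      (\<forall>g\<in>carrier G. \<forall>h\<in>carrier G.
        c *\<^sub>R U (m (X g) (X h)) = (c *\<^sub>R U (X g)) * (c *\<^sub>R U (X h))))"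
proof -
  interpret G: comm_group G by fact
  obtain A :: real where "A > 0"
    and tight: "\<And>x. (\<Sum>g\<in>carrier G. (cmod (cinner x (X g)))\<^sup>2) = A * (norm x)\<^sup>2"
    using assms(3) unfolding tight_frame_def by blast
  obtain \<gamma> :: "'d \<Rightarrow> 'a \<Rightarrow> complex" and w
    where \<gamma>: "range \<gamma> \<subseteq> characters G" "inj \<gamma>"
      and w: "\<And>g i. g \<in> carrier G \<Longrightarrow> cinner (X g) (w i) = \<gamma> i g"
      and orth: "\<And>i j. cinner (w i) (w j) = (if i = j then of_nat (order G) / A else 0)"
    using harmonic_coordinates [OF assms(1,2) \<open>A > 0\<close> tight assms(4)] by blast
  \<comment> \<open>Each \<open>w i\<close> has squared norm \<open>order G / A\<close>, so this
    factor makes the \<open>e i\<close> orthonormal.\<close>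
  define s where "s = sqrt (A / order G)"
  have "order G > 0" using assms(2) by (simp add: G.order_gt_0_iff_finite)
  then have "s > 0" and s2: "s * s = A / order G" using \<open>A > 0\<close> by (simp_all add: s_def)
  define e where "e i = complex_of_real s *s w i" for i
  define U where "U = (\<lambda>x. \<chi> i. cinner x (e i))"
  \<comment> \<open>\<open>U\<close> takes coordinates in the basis \<open>e\<close> and
    \<open>V\<close> is its inverse; equivalence needs \<open>X\<close> expressed through
    \<open>Y\<close>, hence \<open>V\<close>.\<close>
  define V where "V = (\<lambda>y :: complex ^ 'd. \<Sum>i\<in>UNIV. y $ i *s e i)"
  have "complex_of_real s * (complex_of_real s * (of_nat (order G) / complex_of_real A)) =
      complex_of_real ((s * s) * (order G / A))"
    by simp
  also have "\<dots> = 1" unfolding s2 using \<open>A > 0\<close> \<open>order G > 0\<close> by simp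
  finally have "complex_of_real s * (complex_of_real s * (of_nat (order G) / complex_of_real A)) = 1" .
  then have "cinner (e i) (e j) = (if i = j then 1 else 0)" for i j
    by (simp add: e_def cinner_simps orth)
  note onb = unitary_op_orthonormal_basis [of e, OF this]
  have U: "unitary_op U" and V: "unitary_op V" and VU: "V (U x) = x" for x
    using onb by (simp_all only: U_def V_def)
  define Y where "Y g = (\<chi> i. \<gamma> i g)" for g
  have UX: "U (X g) = s *\<^sub>R Y g" if "g \<in> carrier G" for g
    using that by (simp add: U_def Y_def e_def cinner_simps w vec_eq_iff) (simp add: scaleR_conv_of_real)
  have Y: "Y g = (1 / s) *\<^sub>R U (X g)" if "g \<in> carrier G" for g
    using that \<open>s > 0\<close> by (simp add: UX)
  have scaleR: "r *\<^sub>R z = complex_of_real r *s z" for r and z :: "complex ^ 'd"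
    by (simp add: vec_eq_iff) (simp add: scaleR_conv_of_real)
  have X: "X g = s *\<^sub>R V (Y g)" if "g \<in> carrier G" for g
  proof -
    have "clinear V" using V by (simp add: unitary_op_def)
    then have "V (s *\<^sub>R Y g) = s *\<^sub>R V (Y g)" by (simp add: scaleR vec.linear_scale)
    then show ?thesis using VU [of "X g"] by (simp add: UX [OF that])
  qed
  \<comment> \<open>\<open>Y\<close> consists of bare character vectors, so the unitary in the
    definition of a harmonic frame is the identity.\<close>
  have "unitary_op (\<lambda>x :: complex ^ 'd. x)"
    by (simp add: unitary_op_def clinearI surj_def)
  moreover have "bij_betw \<gamma> UNIV (range \<gamma>)" using \<gamma>(2) by (simp add: bij_betw_def)
  ultimately have harmonic: "harmonic_frame G Y"
    unfolding harmonic_frame_def Y_def using \<gamma>(1) by blast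
  \<comment> \<open>Equivalence also asks that \<open>Y\<close> be tight. This is carried over from
    \<open>X\<close> by the isometry \<open>U\<close>, the scaling \<open>1 / s\<close> changing the
    frame constant.\<close>
  have "(\<Sum>g\<in>carrier G. (cmod (cinner x (Y g)))\<^sup>2) = (A / s\<^sup>2) * (norm x)\<^sup>2" for x
  proof -
    obtain y where x: "x = U y" using U unfolding unitary_op_def surj_def by blast
    have inner: "cinner (U a) (U b) = cinner a b" for a b using U by (simp add: unitary_op_def)
    have "complex_of_real ((norm x)\<^sup>2) = complex_of_real ((norm y)\<^sup>2)"
      by (simp only: cinner_self [symmetric] x inner)
    then have nrm: "(norm x)\<^sup>2 = (norm y)\<^sup>2" by (simp only: of_real_eq_iff)
    have "(\<Sum>g\<in>carrier G. (cmod (cinner x (Y g)))\<^sup>2) =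
        (\<Sum>g\<in>carrier G. (cmod (cinner y (X g)))\<^sup>2 / s\<^sup>2)"
    proof (rule sum.cong)
      fix g assume "g \<in> carrier G"
      then have "cinner x (Y g) = cinner y (X g) / s"
        by (simp only: Y scaleR cinner_simps x inner) simp
      then show "(cmod (cinner x (Y g)))\<^sup>2 = (cmod (cinner y (X g)))\<^sup>2 / s\<^sup>2"
        by (simp add: norm_divide power_divide)
    qed simp
    also have "\<dots> = A * (norm y)\<^sup>2 / s\<^sup>2" by (simp add: tight flip: sum_divide_distrib)
    finally show ?thesis by (simp add: nrm)
  qed
  moreover have "A / s\<^sup>2 > 0" using \<open>A > 0\<close> \<open>s > 0\<close> by simp
  ultimately have "tight_frame (carrier G) Y" unfolding tight_frame_def by blast
  then have equivalent: "unitarily_equivalent (carrier G) X Y"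
    unfolding unitarily_equivalent_def using assms(3) V X \<open>s > 0\<close> by blast
  \<comment> \<open>With \<open>c = 1 / s\<close> the map sends \<open>X g\<close> exactly to
    \<open>Y g\<close>, and \<open>Y\<close> is multiplicative in each coordinate because characters
    are.\<close>
  have "(1 / s) *\<^sub>R U (m (X g) (X h)) = ((1 / s) *\<^sub>R U (X g)) * ((1 / s) *\<^sub>R U (X h))"
    if gh: "g \<in> carrier G" "h \<in> carrier G" for g h
  proof -
    have "m (X g) (X h) = X (g \<otimes>\<^bsub>G\<^esub> h)"
      using assms(4) gh by (simp add: frame_multiplication_def)
    moreover have "Y (g \<otimes>\<^bsub>G\<^esub> h) = Y g * Y h"
      using gh \<gamma>(1) by (auto simp: Y_def vec_eq_iff intro!: character_mult)
    ultimately show ?thesis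
      using gh Y [of "g \<otimes>\<^bsub>G\<^esub> h"] Y [of g] Y [of h] by simp
  qed
  moreover have "1 / s > 0" using \<open>s > 0\<close> by simp
  ultimately show ?thesis using harmonic equivalent U by blast
qed

end
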